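(* Suppose that the cost $c(x,y)$ is continuous (A3') and the coordinate transformation $A(s;\omega)$ is continuous (A4'). Additionally, when $\Omega$, $S$, $X$, $X_u$ are all compact and $\Omega_0\subset\Omega$ (with $[0,T]$ possibly not compact), suppose that: (A5') if $\omega(t\mid\omega_0)\in\partial\Omega$ for some $t\in[0,T]$, $\omega_0\in\Omega_0$, then $\omega(t'\mid\omega_0)\notin\Omega$ for all $t'\in(t,T]$; (A6') if there is $s\in S$ such that $A(s;\omega(t\mid\omega_0))\notin X$ or $A(s;\omega(t\mid\omega_0))\in\partial X$ for some $t\in[0,T]$, $\omega_0\in\Omega_0$, then $A(s;\omega(t'\mid\omega_0))\notin X$ for all $t'\in(t,T]$. Let $P^*$ be the shape distance of closest approach (defined in the context), and let $$\begin{aligned} p^*=\inf\ & \langle c(x,y),\eta\rangle\\ \text{s.t. } & \mu_p=\delta_0\otimes\mu_0+\mathcal{L}_f^\dagger\mu,\\ & \pi^\omega_\#\mu_p=\pi^\omega_\#\mu_s,\\ & \pi^x_\#\eta=A(s;\omega)_\#\mu_s,\\ & \langle1,\mu_0\rangle=1,\\ & \mu_0\in\mathcal{M}_+(\Omega_0),\ \eta\in\mathcal{M}_+(X\times X_u),\ \mu_s\in\mathcal{M}_+(\Omega\times S),\ \mu_p,\mu\in\mathcal{M}_+([0,T]\times\Omega).\end{aligned}$$ Then $p^*\le P^*$.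
   Context: $X\subset\mathbb{R}^n$ is a region of space with unsafe set $X_u\subset X$ and $c(x,y)$ is a cost on $X\times X_u$. The orientation state $\omega\in\Omega\subset\mathbb{R}^{N_\omega}$ follows $\dot\omega(t)=f(t,\omega(t))$, with $f$ locally Lipschitz, for $t\in[0,T]$ (with $[0,T]$ read as $[0,\infty)$ if $T=\infty$), and $\omega(t\mid\omega_0)$ denotes the trajectory with $\omega(0)=\omega_0\in\Omega_0\subset\Omega$. The shape is a set $S\subset\mathbb{R}^{N_s}$, and $A(s;\omega)$ transforms local shape coordinates $s\in S$ into global coordinates, with $A(s;\omega)\in X$ for $(s,\omega)\in S\times\Omega$ (in A6', $A$ is understood to be defined at all the states $\omega$ visited). The orientation is restricted to $\Omega$: a pair $(t,\omega_0)\in[0,T]\times\Omega_0$ is admissible if $\omega(\tau\mid\omega_0)$ exists and lies in $\Omega$ for all $\tau\in[0,t]$. The shape distance of closest approach is $$P^*=\inf\{\,c(A(s;\omega(t\mid\omega_0)),y):(t,\omega_0)\text{ admissible},\ s\in S,\ y\in X_u\,\}.$$ $\mathcal{M}_+(\cdot)$ denotes nonnegative Borel measures, $\langle h,\nu\rangle=\int h\,d\nu$, $\pi^\omega_\#$ and $\pi^x_\#$ denote the $\omega$- and $x$-marginals, and $A(s;\omega)_\#\mu_s$ is the pushforward of $\mu_s$ under $(s,\omega)\mapsto A(s;\omega)$, i.e. $\langle w(x),\eta\rangle=\langle w(A(s;\omega)),\mu_s\rangle$ for all $w\in C(X)$. With $\mathcal{L}_f v(t,\omega)=\partial_t v+f\cdot\nabla_\omega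 v$, the constraint $\mu_p=\delta_0\otimes\mu_0+\mathcal{L}_f^\dagger\mu$ means $\langle v(t,\omega),\mu_p\rangle=\langle v(0,\omega),\mu_0\rangle+\langle\mathcal{L}_f v(t,\omega),\mu\rangle$ for all $v$ continuously differentiable on a neighbourhood of $[0,T]\times\Omega$. If the sets are not compact, feasible tuples are those for which all integrals involved are finite. *)

theory Defs
  imports "HOL-Analysis.Analysis"
begin

section \<open>Orientation dynamics\<close>

text \<open>The horizon $T$ is an extended real; for $T = \infty$ the set below is $[0,\infty)$.\<close>

definition horizon :: "ereal \<Rightarrow> real set" where
  "horizon T = {t. 0 \<le> t \<and> ereal t \<le> T}"

text \<open>The library constant \<open>local_lipschitz\<close> only asks for a Lipschitz condition in the second
  argument; here the condition is joint in time and state.\<close>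

definition locally_lipschitz_on ::
    "'a::metric_space set \<Rightarrow> ('a \<Rightarrow> 'b::metric_space) \<Rightarrow> bool" where
  "locally_lipschitz_on D g \<longleftrightarrow> (\<forall>z\<in>D. \<exists>u>0. \<exists>L. L-lipschitz_on (cball z u \<inter> D) g)"

definition solves_ivp ::
    "(real \<Rightarrow> real^'m \<Rightarrow> real^'m) \<Rightarrow> real^'m \<Rightarrow> real \<Rightarrow> (real \<Rightarrow> real^'m) \<Rightarrow> bool" where
  "solves_ivp f \<omega>0 t x \<longleftrightarrow> 0 \<le> t \<and> x 0 = \<omega>0 \<and>
     (\<forall>\<tau>\<in>{0..t}. (x has_vector_derivative f \<tau> (x \<tau>)) (at \<tau> within {0..t}))"

definition flow_exists :: "(real \<Rightarrow> real^'m \<Rightarrow> real^'m) \<Rightarrow> real^'m \<Rightarrow> real \<Rightarrow> bool" where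
  "flow_exists f \<omega>0 t \<longleftrightarrow> (\<exists>x. solves_ivp f \<omega>0 t x)"

text \<open>\<open>flow f \<omega>0 t\<close> is the trajectory $\omega(t \mid \omega_0)$. It is meaningful only when
  \<open>flow_exists f \<omega>0 t\<close>, and is then well defined by the lemma \<open>flow_eq\<close> below.\<close>

definition flow :: "(real \<Rightarrow> real^'m \<Rightarrow> real^'m) \<Rightarrow> real^'m \<Rightarrow> real \<Rightarrow> real^'m" where
  "flow f \<omega>0 t = (THE z. \<exists>x. solves_ivp f \<omega>0 t x \<and> x t = z)"

lemma solves_ivp_unique:
  fixes f :: "real \<Rightarrow> real^'m \<Rightarrow> real^'m"
  assumes lip: "locally_lipschitz_on (horizon T \<times> UNIV) (\<lambda>(t, \<omega>). f t \<omega>)"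
    and t: "t \<in> horizon T"
    and x: "solves_ivp f \<omega>0 t x" and y: "solves_ivp f \<omega>0 t y"
    and \<tau>: "\<tau> \<in> {0..t}"
  shows "x \<tau> = y \<tau>"
proof -
  have sub: "{0..t} \<subseteq> horizon T"
  proof
    fix \<sigma> assume "\<sigma> \<in> {0..t}"
    then have "0 \<le> \<sigma>" "ereal \<sigma> \<le> ereal t" by auto
    then show "\<sigma> \<in> horizon T" using t order_trans unfolding horizon_def by blast
  qed
  have cx: "continuous_on {0..t} x" and cy: "continuous_on {0..t} y"
    using x y unfolding solves_ivp_def
    by (auto intro!: continuous_on_vector_derivative)
  let ?E = "{\<sigma>\<in>{0..t}. x \<sigma> - y \<sigma> = 0}"
  have closed: "closedin (top_of_set {0..t}) ?E"
    by (rule continuous_closedin_preimage_constant) (intro continuous_intros cx cy)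
  have near: "\<exists>d>0. \<forall>\<sigma>\<in>{0..t}. dist \<sigma> s < d \<longrightarrow> \<sigma> \<in> ?E" if s: "s \<in> ?E" for s
  proof -
    have sD: "(s, x s) \<in> horizon T \<times> UNIV" and s0: "s \<in> {0..t}" and sxy: "x s = y s"
      using s sub by auto
    obtain u L where u: "u > 0"
      and L: "L-lipschitz_on (cball (s, x s) u \<inter> (horizon T \<times> UNIV)) (\<lambda>(t, \<omega>). f t \<omega>)"
      using lip sD unfolding locally_lipschitz_on_def by blast
    have L0: "0 \<le> L" using L by (rule lipschitz_on_nonneg)
    have "continuous_on {0..t} (\<lambda>\<sigma>. (\<sigma>, x \<sigma>))" "continuous_on {0..t} (\<lambda>\<sigma>. (\<sigma>, y \<sigma>))"
      by (intro continuous_intros cx cy)+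
    then have "\<exists>d>0. \<forall>\<sigma>\<in>{0..t}. dist \<sigma> s < d \<longrightarrow> dist (\<sigma>, x \<sigma>) (s, x s) < u"
      "\<exists>d>0. \<forall>\<sigma>\<in>{0..t}. dist \<sigma> s < d \<longrightarrow> dist (\<sigma>, y \<sigma>) (s, y s) < u"
      using u s0 unfolding continuous_on_iff by blast+
    then obtain d1 d2 where d1: "d1 > 0" "\<And>\<sigma>. \<sigma> \<in> {0..t} \<Longrightarrow> dist \<sigma> s < d1 \<Longrightarrow> dist (\<sigma>, x \<sigma>) (s, x s) < u"
      and d2: "d2 > 0" "\<And>\<sigma>. \<sigma> \<in> {0..t} \<Longrightarrow> dist \<sigma> s < d2 \<Longrightarrow> dist (\<sigma>, y \<sigma>) (s, y s) < u"
      by blast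
    define d where "d = min (min d1 d2) (1 / (L + 1)) / 2"
    have d0: "d > 0" using d1(1) d2(1) L0 by (simp add: d_def)
    have dd1: "d < d1" "d < d2" using d0 d1(1) d2(1) by (auto simp: d_def min_def)
    have "d < 1 / (L + 1)"
    proof -
      have "d \<le> (1 / (L + 1)) / 2" unfolding d_def by (intro divide_right_mono) auto
      moreover have "1 / (L + 1) > 0" using L0 by simp
      moreover have "d < b" if "d \<le> b / 2" "0 < b" for b using that by linarith
      ultimately show ?thesis by blast
    qed
    then have Ld: "L * d < 1" using L0 d0 by (simp add: field_simps)
    let ?D = "cball s d \<inter> {0..t}"
    have Dcb: "?D = {max 0 (s - d)..min t (s + d)}"
      by (auto simp: dist_real_def)
    have sin: "s \<in> ?D" using s0 d0 by auto
    have "compact ?D" by (simp add: compact_Int)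
    moreover have "continuous_on ?D (\<lambda>\<sigma>. norm (x \<sigma> - y \<sigma>))"
      by (intro continuous_intros continuous_on_subset[OF cx] continuous_on_subset[OF cy]) auto
    ultimately obtain m where m: "m \<in> ?D" "\<And>\<sigma>. \<sigma> \<in> ?D \<Longrightarrow> norm (x \<sigma> - y \<sigma>) \<le> norm (x m - y m)"
      using continuous_attains_sup[of ?D "\<lambda>\<sigma>. norm (x \<sigma> - y \<sigma>)"] sin by blast
    let ?B = "L * norm (x m - y m)"
    have der: "((\<lambda>\<sigma>. x \<sigma> - y \<sigma>) has_derivative (\<lambda>h. h *\<^sub>R (f \<sigma> (x \<sigma>) - f \<sigma> (y \<sigma>)))) (at \<sigma> within ?D)"
      if "\<sigma> \<in> ?D" for \<sigma>
    proof -
      have "((\<lambda>\<sigma>. x \<sigma> - y \<sigma>) has_vector_derivative (f \<sigma> (x \<sigma>) - f \<sigma> (y \<sigma>))) (at \<sigma> within {0..t})"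
        using x y that unfolding solves_ivp_def by (intro has_vector_derivative_diff) auto
      then show ?thesis
        unfolding has_vector_derivative_def by (rule has_derivative_subset) auto
    qed
    have bnd: "onorm (\<lambda>h. h *\<^sub>R (f \<sigma> (x \<sigma>) - f \<sigma> (y \<sigma>))) \<le> ?B" if "\<sigma> \<in> ?D" for \<sigma>
    proof (rule onorm_bound)
      show "0 \<le> ?B" using L0 by simp
      fix h :: real
      have \<sigma>d: "dist \<sigma> s < d1" "dist \<sigma> s < d2" "\<sigma> \<in> {0..t}"
        using that dd1 by (auto simp: dist_commute)
      have "(\<sigma>, x \<sigma>) \<in> cball (s, x s) u \<inter> (horizon T \<times> UNIV)"
        using d1(2)[OF \<sigma>d(3,1)] \<sigma>d(3) sub by (auto simp: dist_commute)
      moreover have "(\<sigma>, y \<sigma>) \<in> cball (s, x s) u \<inter> (horizon T \<times> UNIV)"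
        using d2(2)[OF \<sigma>d(3,2)] \<sigma>d(3) sub sxy by (auto simp: dist_commute)
      ultimately have "dist (f \<sigma> (x \<sigma>)) (f \<sigma> (y \<sigma>)) \<le> L * dist (\<sigma>, x \<sigma>) (\<sigma>, y \<sigma>)"
        using lipschitz_onD[OF L, of "(\<sigma>, x \<sigma>)" "(\<sigma>, y \<sigma>)"] by simp
      also have "\<dots> = L * norm (x \<sigma> - y \<sigma>)"
        by (simp add: dist_Pair_Pair dist_norm)
      also have "\<dots> \<le> ?B"
        using m(2)[OF that] L0 by (rule mult_left_mono)
      finally have "norm (f \<sigma> (x \<sigma>) - f \<sigma> (y \<sigma>)) \<le> ?B" by (simp add: dist_norm)
      then show "norm (h *\<^sub>R (f \<sigma> (x \<sigma>) - f \<sigma> (y \<sigma>))) \<le> ?B * norm h"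
        by (simp add: mult.commute mult_left_mono)
    qed
    have "norm ((x m - y m) - (x s - y s)) \<le> ?B * norm (m - s)"
      by (rule differentiable_bound[of ?D "\<lambda>\<sigma>. x \<sigma> - y \<sigma>"
            "\<lambda>\<sigma> h. h *\<^sub>R (f \<sigma> (x \<sigma>) - f \<sigma> (y \<sigma>))" ?B m s])
         (use der bnd m(1) sin in \<open>auto simp: convex_Int\<close>)
    also have "\<dots> \<le> ?B * d"
      using m(1) L0 by (intro mult_left_mono) (auto simp: dist_real_def)
    finally have le: "norm (x m - y m) \<le> (L * d) * norm (x m - y m)"
      using sxy by (simp add: algebra_simps)
    have "norm (x m - y m) = 0"
    proof (rule ccontr)
      assume "norm (x m - y m) \<noteq> 0"
      then have "norm (x m - y m) > 0" by simp
      from mult_strict_right_mono[OF Ld this] le show False by simp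
    qed
    then have "\<sigma> \<in> ?E" if "\<sigma> \<in> {0..t}" "dist \<sigma> s < d" for \<sigma>
      using m(2)[of \<sigma>] that by (auto simp: dist_commute)
    then show ?thesis using d0 by blast
  qed
  have "openin (top_of_set {0..t}) ?E"
    unfolding openin_euclidean_subtopology_iff using near by auto
  then have E: "?E = {} \<or> ?E = {0..t}"
    using closed connected_clopen[THEN iffD1, OF connected_Icc[of 0 t], rule_format, of ?E] by simp
  have "0 \<in> ?E" using x y by (auto simp: solves_ivp_def)
  then have "?E \<noteq> {}" by (rule ex_in_conv[THEN iffD1, OF exI])
  from disjE[OF E notE[OF this]] have "?E = {0..t}" by this
  with \<tau> have "\<tau> \<in> ?E" by (simp only:)
  then show ?thesis by simp
qed

lemma flow_eq:
  fixes f :: "real \<Rightarrow> real^'m \<Rightarrow> real^'m"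
  assumes "locally_lipschitz_on (horizon T \<times> UNIV) (\<lambda>(t, \<omega>). f t \<omega>)"
    and "t \<in> horizon T" and "solves_ivp f \<omega>0 t x"
  shows "flow f \<omega>0 t = x t"
  unfolding flow_def
proof (rule the_equality)
  show "\<exists>x'. solves_ivp f \<omega>0 t x' \<and> x' t = x t"
    using assms(3) by blast
  fix z
  assume "\<exists>x'. solves_ivp f \<omega>0 t x' \<and> x' t = z"
  then obtain x' where x': "solves_ivp f \<omega>0 t x'" "x' t = z" by blast
  have "t \<in> {0..t}" using assms(3) by (simp add: solves_ivp_def)
  from solves_ivp_unique[OF assms(1,2) x'(1) assms(3) this] x'(2) show "z = x t" by simp
qed

definition admissible ::
    "ereal \<Rightarrow> (real \<Rightarrow> real^'m \<Rightarrow> real^'m) \<Rightarrow> (real^'m) set \<Rightarrow> (real^'m) set \<Rightarrow> real \<Rightarrow> real^'m \<Rightarrow> bool"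
  where
  "admissible T f \<Omega> \<Omega>0 t \<omega>0 \<longleftrightarrow> t \<in> horizon T \<and> \<omega>0 \<in> \<Omega>0 \<and>
     (\<forall>\<tau>\<in>{0..t}. flow_exists f \<omega>0 \<tau> \<and> flow f \<omega>0 \<tau> \<in> \<Omega>)"

text \<open>In the two non-return conditions only times at which the trajectory exists are considered.\<close>

definition no_return_orientation ::
    "ereal \<Rightarrow> (real \<Rightarrow> real^'m \<Rightarrow> real^'m) \<Rightarrow> (real^'m) set \<Rightarrow> (real^'m) set \<Rightarrow> bool" where
  "no_return_orientation T f \<Omega> \<Omega>0 \<longleftrightarrow>
     (\<forall>\<omega>0\<in>\<Omega>0. \<forall>t\<in>horizon T. flow_exists f \<omega>0 t \<longrightarrow> flow f \<omega>0 t \<in> frontier \<Omega> \<longrightarrow>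
        (\<forall>t'\<in>horizon T. t < t' \<longrightarrow> flow_exists f \<omega>0 t' \<longrightarrow> flow f \<omega>0 t' \<notin> \<Omega>))"

definition no_return_shape ::
    "ereal \<Rightarrow> (real \<Rightarrow> real^'m \<Rightarrow> real^'m) \<Rightarrow> (real^'m) set \<Rightarrow>
     (real^'k \<Rightarrow> real^'m \<Rightarrow> real^'n) \<Rightarrow> (real^'k) set \<Rightarrow> (real^'n) set \<Rightarrow> bool" where
  "no_return_shape T f \<Omega>0 A S X \<longleftrightarrow>
     (\<forall>\<omega>0\<in>\<Omega>0. \<forall>s\<in>S. \<forall>t\<in>horizon T. flow_exists f \<omega>0 t \<longrightarrow>
        A s (flow f \<omega>0 t) \<notin> X \<or> A s (flow f \<omega>0 t) \<in> frontier X \<longrightarrow>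
        (\<forall>t'\<in>horizon T. t < t' \<longrightarrow> flow_exists f \<omega>0 t' \<longrightarrow> A s (flow f \<omega>0 t') \<notin> X))"

definition shape_distance ::
    "ereal \<Rightarrow> (real \<Rightarrow> real^'m \<Rightarrow> real^'m) \<Rightarrow> (real^'m) set \<Rightarrow> (real^'m) set \<Rightarrow>
     (real^'k \<Rightarrow> real^'m \<Rightarrow> real^'n) \<Rightarrow> (real^'k) set \<Rightarrow> (real^'n) set \<Rightarrow>
     (real^'n \<Rightarrow> real^'n \<Rightarrow> real) \<Rightarrow> ereal" where
  "shape_distance T f \<Omega> \<Omega>0 A S Xu c =
     Inf {ereal (c (A s (flow f \<omega>0 t)) y) | t \<omega>0 s y.
            admissible T f \<Omega> \<Omega>0 t \<omega>0 \<and> s \<in> S \<and> y \<in> Xu}"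

section \<open>The measure program\<close>

definition grad :: "('a::real_inner \<Rightarrow> real) \<Rightarrow> 'a \<Rightarrow> 'a" where
  "grad g x = (THE D. GDERIV g x :> D)"

definition lie_deriv ::
    "(real \<Rightarrow> real^'m \<Rightarrow> real^'m) \<Rightarrow> (real \<times> (real^'m) \<Rightarrow> real) \<Rightarrow> real \<times> (real^'m) \<Rightarrow> real" where
  "lie_deriv f v = (\<lambda>(t, \<omega>). deriv (\<lambda>\<tau>. v (\<tau>, \<omega>)) t + f t \<omega> \<bullet> grad (\<lambda>z. v (t, z)) \<omega>)"

definition C1_near :: "'a::real_normed_vector set \<Rightarrow> ('a \<Rightarrow> real) \<Rightarrow> bool" where
  "C1_near D v \<longleftrightarrow> (\<exists>U v'. open U \<and> D \<subseteq> U \<and>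
     (\<forall>z\<in>U. (v has_derivative blinfun_apply (v' z)) (at z)) \<and> continuous_on U v')"

text \<open>Nonnegative Borel measures on \<open>D\<close>. Finiteness is not required here; it follows from the
  integrability conditions in \<open>feasible\<close> (taking the constant test function \<open>v = 1\<close>, and
  \<open>v = t\<close> for \<open>\<mu>\<close>).\<close>

definition borel_measures :: "'a::topological_space set \<Rightarrow> 'a measure set" where
  "borel_measures D = {M. sets M = sets (restrict_space borel D)}"

text \<open>The Bochner integral of a non-integrable function is \<open>0\<close> by convention, so
  integrability of every integrand is required explicitly. This includes the integrals
  $\langle w(x), \eta\rangle = \langle w(A(s;\omega)), \mu_s\rangle$ for continuous \<open>w\<close> that
  define the pushforward constraint. When the sets and the horizon are compact, integrability
  holds automatically for finite measures.\<close>

definition feasible ::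
    "ereal \<Rightarrow> (real \<Rightarrow> real^'m \<Rightarrow> real^'m) \<Rightarrow> (real^'m) set \<Rightarrow> (real^'m) set \<Rightarrow>
     (real^'k \<Rightarrow> real^'m \<Rightarrow> real^'n) \<Rightarrow> (real^'k) set \<Rightarrow> (real^'n) set \<Rightarrow> (real^'n) set \<Rightarrow>
     (real^'n \<Rightarrow> real^'n \<Rightarrow> real) \<Rightarrow>
     (real^'m) measure \<Rightarrow> (real \<times> (real^'m)) measure \<Rightarrow> (real \<times> (real^'m)) measure \<Rightarrow>
     ((real^'m) \<times> (real^'k)) measure \<Rightarrow> ((real^'n) \<times> (real^'n)) measure \<Rightarrow> bool" where
  "feasible T f \<Omega> \<Omega>0 A S X Xu c \<mu>0 \<mu>p \<mu> \<mu>s \<eta> \<longleftrightarrow>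
     \<mu>0 \<in> borel_measures \<Omega>0 \<and>
     \<eta> \<in> borel_measures (X \<times> Xu) \<and>
     \<mu>s \<in> borel_measures (\<Omega> \<times> S) \<and>
     \<mu>p \<in> borel_measures (horizon T \<times> \<Omega>) \<and>
     \<mu> \<in> borel_measures (horizon T \<times> \<Omega>) \<and>
     (\<forall>v. C1_near (horizon T \<times> \<Omega>) v \<longrightarrow>
        integrable \<mu>p v \<and> integrable \<mu>0 (\<lambda>\<omega>. v (0, \<omega>)) \<and> integrable \<mu> (lie_deriv f v) \<and>
        (\<integral>z. v z \<partial>\<mu>p) = (\<integral>\<omega>. v (0, \<omega>) \<partial>\<mu>0) + (\<integral>z. lie_deriv f v z \<partial>\<mu>)) \<and>
     distr \<mu>p (restrict_space borel \<Omega>) snd = distr \<mu>s (restrict_space borel \<Omega>) fst \<and>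
     distr \<eta> (restrict_space borel X) fst =
       distr \<mu>s (restrict_space borel X) (\<lambda>(\<omega>, s). A s \<omega>) \<and>
     (\<forall>w. continuous_on X w \<longrightarrow>
        integrable \<eta> (\<lambda>(x, y). w x :: real) \<and> integrable \<mu>s (\<lambda>(\<omega>, s). w (A s \<omega>))) \<and>
     emeasure \<mu>0 (space \<mu>0) = 1 \<and>
     integrable \<eta> (\<lambda>(x, y). c x y)"

definition measure_program_value ::
    "ereal \<Rightarrow> (real \<Rightarrow> real^'m \<Rightarrow> real^'m) \<Rightarrow> (real^'m) set \<Rightarrow> (real^'m) set \<Rightarrow>
     (real^'k \<Rightarrow> real^'m \<Rightarrow> real^'n) \<Rightarrow> (real^'k) set \<Rightarrow> (real^'n) set \<Rightarrow> (real^'n) set \<Rightarrow>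
     (real^'n \<Rightarrow> real^'n \<Rightarrow> real) \<Rightarrow> ereal" where
  "measure_program_value T f \<Omega> \<Omega>0 A S X Xu c =
     Inf {ereal (\<integral>(x, y). c x y \<partial>\<eta>) | \<mu>0 \<mu>p \<mu> \<mu>s \<eta>.
            feasible T f \<Omega> \<Omega>0 A S X Xu c \<mu>0 \<mu>p \<mu> \<mu>s \<eta>}"

end

theory Submission
  imports Defs "HOL-Probability.Giry_Monad"
begin

text \<open>Every point competing in the shape distance yields a feasible tuple of the same cost: Dirac
  measures at the initial state, at the terminal time and state, at the shape point and at the pair
  of closest points, together with the occupation measure of the trajectory, that is, the image of
  Lebesgue measure on $[0,t]$ under $\tau \mapsto (\tau, \omega(\tau \mid \omega_0))$. The
  Liouville equation for this tuple is the fundamental theorem of calculus along the trajectory.\<close>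

section \<open>Dirac measures on Borel subspaces\<close>

lemma measurable_restrict_borel_continuous_on:
  assumes "continuous_on D g" and "g ` D \<subseteq> E"
  shows "g \<in> measurable (restrict_space borel D) (restrict_space borel E)"
  using assms
  by (intro measurable_restrict_space2 borel_measurable_continuous_on_restrict)
     (auto simp: space_restrict_space)

lemma return_restrict_borel_measures: "return (restrict_space borel D) a \<in> borel_measures D"
  by (simp add: borel_measures_def)

lemma distr_return_restrict_borel:
  assumes "continuous_on D g" and "g ` D \<subseteq> E" and "a \<in> D"
  shows "distr (return (restrict_space borel D) a) (restrict_space borel E) g =
    return (restrict_space borel E) (g a)"
  using assms by (intro distr_return measurable_restrict_borel_continuous_on)
    (auto simp: space_restrict_space)

text \<open>Integrability and value are stated together because \<open>feasible\<close> demands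
  both. Even an unbounded \<open>g\<close> is integrable, as the integral of
  \<open>norm (g z)\<close> against the Dirac measure is the finite number
  \<open>norm (g a)\<close>.\<close>

lemma has_bochner_integral_return_restrict_borel:
  fixes g :: "'a::topological_space \<Rightarrow> real"
  assumes "continuous_on D g" and "a \<in> D"
  shows "has_bochner_integral (return (restrict_space borel D) a) g (g a)"
proof -
  have a: "a \<in> space (restrict_space borel D)"
    using assms by (simp add: space_restrict_space)
  have g: "g \<in> borel_measurable (restrict_space borel D)"
    using assms by (intro borel_measurable_continuous_on_restrict)
  have "integrable (return (restrict_space borel D) a) g"
    using g a by (intro integrableI_bounded) (auto simp: nn_integral_return)
  then show ?thesis
    using integral_return[OF a g] by (simp add: has_bochner_integral_iff)
qed

section \<open>Continuity of the dynamics, gradient and Lie derivative\<close>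

lemma locally_lipschitz_on_imp_continuous_on:
  assumes "locally_lipschitz_on D g"
  shows "continuous_on D g"
  unfolding continuous_on_eq_continuous_within
proof
  fix z assume z: "z \<in> D"
  obtain u L where u: "u > 0" and L: "L-lipschitz_on (cball z u \<inter> D) g"
    using assms z unfolding locally_lipschitz_on_def by blast
  have "continuous (at z within cball z u \<inter> D) g"
    using lipschitz_on_continuous_on[OF L] z u by (simp add: continuous_on_eq_continuous_within)
  \<comment> \<open>On the open ball of radius \<open>u\<close> the sets \<open>D\<close> and
    \<open>cball z u \<inter> D\<close> agree, and limits at \<open>z\<close> see nothing
    else.\<close>
  moreover have "at z within D = at z within cball z u \<inter> D"
    by (rule at_within_nhd[of _ "ball z u"]) (use u in auto)
  ultimately show "continuous (at z within D) g" by simp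
qed

text \<open>Since \<open>grad\<close> is a definite description, existence and uniqueness are both
  required. The vector representing the functional \<open>g'\<close> is \<open>adjoint g' 1\<close>;
  any other gradient represents the same derivative, hence is the same vector.\<close>

lemma grad_inner_eq:
  fixes g :: "'a::euclidean_space \<Rightarrow> real"
  assumes "(g has_derivative g') (at x)"
  shows "h \<bullet> grad g x = g' h"
proof -
  have lin: "linear g'"
    using assms by (rule has_derivative_linear)
  have adj: "(\<lambda>h. h \<bullet> adjoint g' 1) = g'"
    using adjoint_works[OF lin] by (simp add: fun_eq_iff)
  have "GDERIV g x :> adjoint g' 1"
    unfolding gderiv_def adj by (rule assms)
  moreover have "D = adjoint g' 1" if "GDERIV g x :> D" for D
  proof -
    have "(\<lambda>h. h \<bullet> D) = (\<lambda>h. h \<bullet> adjoint g' 1)"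
      unfolding adj using that assms unfolding gderiv_def by (rule has_derivative_unique)
    then show ?thesis by (simp add: fun_eq_iff vector_eq_ldot)
  qed
  ultimately have "grad g x = adjoint g' 1"
    unfolding grad_def by (rule the_equality)
  then show ?thesis using fun_cong[OF adj] by simp
qed

text \<open>Splitting the direction \<open>(1, f t \<omega>)\<close> into \<open>(1, 0)\<close> and
  \<open>(0, f t \<omega>)\<close> separates the total derivative into the two partial terms of
  \<open>lie_deriv\<close>. In this form it matches the chain rule along a trajectory.\<close>

lemma lie_deriv_eq:
  assumes v: "(v has_derivative blinfun_apply v') (at (t, \<omega>))"
  shows "lie_deriv f v (t, \<omega>) = blinfun_apply v' (1, f t \<omega>)"
proof -
  have "((\<lambda>\<tau>. v (\<tau>, \<omega>)) has_derivative (\<lambda>h. blinfun_apply v' (h, 0))) (at t)"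
    by (rule has_derivative_compose[OF has_derivative_Pair[OF has_derivative_ident has_derivative_const] v])
  moreover have "(\<lambda>h. blinfun_apply v' (h, 0)) = (*) (blinfun_apply v' (1, 0))"
  proof
    show "blinfun_apply v' (h, 0) = blinfun_apply v' (1, 0) * h" for h
      using blinfun.scaleR_right[of v' h "(1, 0)"] by simp
  qed
  ultimately have "deriv (\<lambda>\<tau>. v (\<tau>, \<omega>)) t = blinfun_apply v' (1, 0)"
    by (intro DERIV_imp_deriv) (simp only: has_field_derivative_def)
  moreover have "((\<lambda>z. v (t, z)) has_derivative (\<lambda>h. blinfun_apply v' (0, h))) (at \<omega>)"
    by (rule has_derivative_compose[OF has_derivative_Pair[OF has_derivative_const has_derivative_ident] v])
  then have "f t \<omega> \<bullet> grad (\<lambda>z. v (t, z)) \<omega> = blinfun_apply v' (0, f t \<omega>)"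
    by (rule grad_inner_eq)
  ultimately show ?thesis
    using blinfun.add_right[of v' "(1, 0)" "(0, f t \<omega>)"] by (simp add: lie_deriv_def)
qed

section \<open>Occupation measure and Liouville equation\<close>

text \<open>The set \<open>D\<close> fixes the sigma-algebra of the image measure, which places it
  in \<open>borel_measures D\<close>.\<close>

definition occupation_measure ::
    "real \<Rightarrow> (real \<Rightarrow> 'b::topological_space) \<Rightarrow>
     (real \<times> 'b) set \<Rightarrow> (real \<times> 'b) measure" where
  "occupation_measure t x D =
     distr (restrict_space lborel {0..t}) (restrict_space borel D) (\<lambda>\<tau>. (\<tau>, x \<tau>))"

text \<open>A change of variables turns the integral into that of \<open>g\<close> along the curve
  over \<open>[0,t]\<close>, and the antiderivative \<open>F\<close> gives its value by the
  fundamental theorem of calculus.\<close>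

lemma has_bochner_integral_occupation_measure:
  fixes g :: "real \<times> 'b::second_countable_topology \<Rightarrow> real"
  assumes x: "continuous_on {0..t} x" and D: "\<And>\<tau>. \<tau> \<in> {0..t} \<Longrightarrow> (\<tau>, x \<tau>) \<in> D"
    and g: "continuous_on D g"
    and t: "0 \<le> t"
    and F: "\<And>\<tau>. \<tau> \<in> {0..t} \<Longrightarrow> (F has_vector_derivative g (\<tau>, x \<tau>)) (at \<tau> within {0..t})"
  shows "has_bochner_integral (occupation_measure t x D) g (F t - F 0)"
proof -
  let ?p = "\<lambda>\<tau>. (\<tau>, x \<tau>)"
  have p: "continuous_on {0..t} ?p"
    by (intro continuous_intros x)
  have "?p \<in> measurable (restrict_space borel {0..t}) (restrict_space borel D)"
    using p D by (intro measurable_restrict_borel_continuous_on) auto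
  then have pm: "?p \<in> measurable (restrict_space lborel {0..t}) (restrict_space borel D)"
    by (simp cong: measurable_cong_sets add: sets_restrict_space)
  have gm: "g \<in> borel_measurable (restrict_space borel D)"
    using g by (rule borel_measurable_continuous_on_restrict)
  have gp: "continuous_on {0..t} (\<lambda>\<tau>. g (\<tau>, x \<tau>))"
    by (rule continuous_on_compose2[OF g p]) (use D in auto)
  \<comment> \<open>Compactness of \<open>[0,t]\<close> gives integrability even when
    \<open>D\<close> is not compact.\<close>
  have "integrable (restrict_space lborel {0..t}) (\<lambda>\<tau>. g (\<tau>, x \<tau>))"
    using borel_integrable_atLeastAtMost'[OF gp]
    by (simp add: integrable_restrict_space set_integrable_def)
  moreover have "(\<integral>\<tau>. g (\<tau>, x \<tau>) \<partial>restrict_space lborel {0..t}) = F t - F 0"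
    using integral_FTC_atLeastAtMost[OF t _ gp, of F] F by (simp add: integral_restrict_space)
  ultimately show ?thesis
    unfolding occupation_measure_def has_bochner_integral_iff
    by (simp add: integrable_distr_eq[OF pm gm] integral_distr[OF pm gm])
qed

text \<open>By the chain rule, \<open>lie_deriv f v\<close> along the trajectory is the time
  derivative of \<open>v (\<tau>, x \<tau>)\<close>, so its integral is the increment of
  \<open>v\<close> between the two ends.\<close>

lemma liouville_equation_trajectory:
  fixes f :: "real \<Rightarrow> real^'m \<Rightarrow> real^'m"
  assumes f: "continuous_on D (\<lambda>(t, \<omega>). f t \<omega>)"
    and x: "solves_ivp f \<omega>0 t x" and D: "\<And>\<tau>. \<tau> \<in> {0..t} \<Longrightarrow> (\<tau>, x \<tau>) \<in> D"
    and v: "C1_near D v"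
  shows "has_bochner_integral (occupation_measure t x D) (lie_deriv f v) (v (t, x t) - v (0, \<omega>0))"
proof -
  obtain U v' where U: "D \<subseteq> U"
    and dv: "\<And>z. z \<in> U \<Longrightarrow> (v has_derivative blinfun_apply (v' z)) (at z)"
    and cv: "continuous_on U v'"
    using v unfolding C1_near_def by blast
  have xt: "0 \<le> t" "x 0 = \<omega>0"
    and dx: "\<And>\<tau>. \<tau> \<in> {0..t} \<Longrightarrow> (x has_vector_derivative f \<tau> (x \<tau>)) (at \<tau> within {0..t})"
    using x by (auto simp: solves_ivp_def)
  have cx: "continuous_on {0..t} x"
    using dx by (rule continuous_on_vector_derivative)
  \<comment> \<open>Continuity of the Lie derivative is read off from that of \<open>v'\<close> and
    \<open>f\<close>, as \<open>deriv\<close> and \<open>grad\<close> carry no regularity by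
    themselves.\<close>
  have lie: "lie_deriv f v z = blinfun_apply (v' z) (1, (\<lambda>(t, \<omega>). f t \<omega>) z)" if "z \<in> D" for z
    using lie_deriv_eq[of v "v' z" "fst z" "snd z" f] dv[of z] U that by (auto split: prod.split)
  have "continuous_on D (\<lambda>z. blinfun_apply (v' z) (1, (\<lambda>(t, \<omega>). f t \<omega>) z))"
    by (intro continuous_intros continuous_on_subset[OF cv U] f)
  then have cl: "continuous_on D (lie_deriv f v)"
    using lie by (simp cong: continuous_on_cong)
  have "((\<lambda>\<tau>. v (\<tau>, x \<tau>)) has_vector_derivative lie_deriv f v (\<tau>, x \<tau>)) (at \<tau> within {0..t})"
    if \<tau>: "\<tau> \<in> {0..t}" for \<tau>
  proof -
    have "((\<lambda>\<tau>. (\<tau>, x \<tau>)) has_derivative (\<lambda>h. h *\<^sub>R (1, f \<tau> (x \<tau>)))) (at \<tau> within {0..t})"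
      using dx[OF \<tau>] unfolding has_vector_derivative_def
      by (auto intro!: derivative_eq_intros)
    \<comment> \<open>The derivative of \<open>v\<close> is two-sided, so the chain rule also covers
      the ends of \<open>[0,t]\<close>, where that of the curve is one-sided.\<close>
    moreover have "(v has_derivative blinfun_apply (v' (\<tau>, x \<tau>))) (at (\<tau>, x \<tau>))"
      using dv D[OF \<tau>] U by auto
    ultimately have "((\<lambda>\<tau>. v (\<tau>, x \<tau>)) has_derivative
        (\<lambda>h. blinfun_apply (v' (\<tau>, x \<tau>)) (h *\<^sub>R (1, f \<tau> (x \<tau>))))) (at \<tau> within {0..t})"
      by (rule has_derivative_compose)
    \<comment> \<open>Without \<open>scaleR_Pair\<close> the vector
      \<open>h *\<^sub>R (1, f \<tau> (x \<tau>))\<close> stays intact, and linearity pulls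
      \<open>h\<close> out.\<close>
    then show ?thesis
      using lie[OF D[OF \<tau>]]
      by (simp add: has_vector_derivative_def blinfun.scaleR_right del: scaleR_Pair)
  qed
  from has_bochner_integral_occupation_measure[OF cx D cl xt(1) this] xt(2)
  show ?thesis by simp
qed

section \<open>Feasible tuples from admissible trajectories\<close>

lemma C1_near_continuous_on:
  assumes "C1_near D v"
  shows "continuous_on D v"
proof -
  obtain U v' where "D \<subseteq> U" and dv: "\<And>z. z \<in> U \<Longrightarrow> (v has_derivative blinfun_apply (v' z)) (at z)"
    using assms unfolding C1_near_def by blast
  then show ?thesis
    by (intro continuous_at_imp_continuous_on) (blast intro: has_derivative_continuous)
qed

lemma horizon_interval_subset: "t \<in> horizon T \<Longrightarrow> {0..t} \<subseteq> horizon T"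
  unfolding horizon_def by (auto intro: order_trans[of "ereal _" "ereal t"])

lemma solves_ivp_mono:
  assumes "solves_ivp f \<omega>0 t x" and "0 \<le> \<tau>" and "\<tau> \<le> t"
  shows "solves_ivp f \<omega>0 \<tau> x"
  using assms unfolding solves_ivp_def
  by (auto intro: has_vector_derivative_within_subset[where S = "{0..t}"])

text \<open>Integrals against Dirac measures are evaluations. With \<open>x\<close> the trajectory,
  the Liouville constraint says that \<open>v (t, x t)\<close> is \<open>v (0, \<omega>0)\<close>
  plus the increment of \<open>v\<close>; both orientation marginals are the Dirac measure at
  \<open>x t\<close>, and both sides of the pushforward constraint are the one at
  \<open>A s (x t)\<close>.\<close>

lemma feasible_trajectory:
  fixes f :: "real \<Rightarrow> real^'m \<Rightarrow> real^'m"
  assumes \<Omega>0: "\<Omega>0 \<subseteq> \<Omega>"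
    and lip: "locally_lipschitz_on (horizon T \<times> UNIV) (\<lambda>(t, \<omega>). f t \<omega>)"
    and AX: "\<And>s \<omega>. s \<in> S \<Longrightarrow> \<omega> \<in> \<Omega> \<Longrightarrow> A s \<omega> \<in> X"
    and c: "continuous_on (X \<times> Xu) (\<lambda>(x, y). c x y)"
    and A: "continuous_on (S \<times> \<Omega>) (\<lambda>(s, \<omega>). A s \<omega>)"
    and adm: "admissible T f \<Omega> \<Omega>0 t \<omega>0" and s: "s \<in> S" and y: "y \<in> Xu"
  shows "\<exists>\<mu>0 \<mu>p \<mu> \<mu>s \<eta>. feasible T f \<Omega> \<Omega>0 A S X Xu c \<mu>0 \<mu>p \<mu> \<mu>s \<eta> \<and>
    (\<integral>(x, y). c x y \<partial>\<eta>) = c (A s (flow f \<omega>0 t)) y"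
proof -
  let ?D = "horizon T \<times> \<Omega>"
  have t: "t \<in> horizon T" and \<omega>0: "\<omega>0 \<in> \<Omega>0"
    and ex: "\<And>\<tau>. \<tau> \<in> {0..t} \<Longrightarrow> flow_exists f \<omega>0 \<tau>"
    and fl: "\<And>\<tau>. \<tau> \<in> {0..t} \<Longrightarrow> flow f \<omega>0 \<tau> \<in> \<Omega>"
    using adm unfolding admissible_def by auto
  have t0: "0 \<le> t" using t by (simp add: horizon_def)
  obtain x where x: "solves_ivp f \<omega>0 t x"
    using ex[of t] t0 unfolding flow_exists_def by auto
  \<comment> \<open>Admissibility provides a solution for each \<open>\<tau>\<close> separately; by
    uniqueness the single solution \<open>x\<close> on \<open>[0,t]\<close> represents them
    all.\<close>
  have xfl: "flow f \<omega>0 \<tau> = x \<tau>" if "\<tau> \<in> {0..t}" for \<tau>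
    using that horizon_interval_subset[OF t]
    by (intro flow_eq[OF lip] solves_ivp_mono[OF x]) auto
  have xD: "(\<tau>, x \<tau>) \<in> ?D" if "\<tau> \<in> {0..t}" for \<tau>
    using that fl[OF that] xfl[OF that] horizon_interval_subset[OF t] by auto
  have xt: "x t \<in> \<Omega>" "(t, x t) \<in> ?D" using xD[of t] t0 by auto
  have fD: "continuous_on ?D (\<lambda>(t, \<omega>). f t \<omega>)"
    by (rule continuous_on_subset[OF locally_lipschitz_on_imp_continuous_on[OF lip]]) auto
  \<comment> \<open>The measure \<open>\<mu>s\<close> lives on pairs \<open>(\<omega>, s)\<close>,
    whereas continuity of \<open>A\<close> is given in the order
    \<open>(s, \<omega>)\<close>.\<close>
  have A': "continuous_on (\<Omega> \<times> S) (\<lambda>(\<omega>, s). A s \<omega>)"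
    using continuous_on_compose2[OF A continuous_on_swap, of "\<Omega> \<times> S"]
    by (simp add: case_prod_unfold product_swap)
  define \<mu>0 where "\<mu>0 = return (restrict_space borel \<Omega>0) \<omega>0"
  define \<mu>p where "\<mu>p = return (restrict_space borel ?D) (t, x t)"
  define \<mu> where "\<mu> = occupation_measure t x ?D"
  define \<mu>s where "\<mu>s = return (restrict_space borel (\<Omega> \<times> S)) (x t, s)"
  define \<eta> where "\<eta> = return (restrict_space borel (X \<times> Xu)) (A s (x t), y)"
  have \<eta>pt: "(A s (x t), y) \<in> X \<times> Xu" and \<mu>spt: "(x t, s) \<in> \<Omega> \<times> S"
    using AX[OF s xt(1)] xt(1) s y by auto
  have cost: "has_bochner_integral \<eta> (\<lambda>(x, y). c x y) (c (A s (x t)) y)"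
    using has_bochner_integral_return_restrict_borel[OF c \<eta>pt] by (simp add: \<eta>_def)
  have borel: "\<mu>0 \<in> borel_measures \<Omega>0" "\<eta> \<in> borel_measures (X \<times> Xu)"
    "\<mu>s \<in> borel_measures (\<Omega> \<times> S)" "\<mu>p \<in> borel_measures ?D" "\<mu> \<in> borel_measures ?D"
    unfolding \<mu>0_def \<mu>p_def \<mu>s_def \<eta>_def
    by (simp_all only: return_restrict_borel_measures)
       (simp add: \<mu>_def borel_measures_def occupation_measure_def)
  have liouville: "integrable \<mu>p v \<and> integrable \<mu>0 (\<lambda>\<omega>. v (0, \<omega>)) \<and> integrable \<mu> (lie_deriv f v) \<and>
      (\<integral>z. v z \<partial>\<mu>p) = (\<integral>\<omega>. v (0, \<omega>) \<partial>\<mu>0) + (\<integral>z. lie_deriv f v z \<partial>\<mu>)"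
    if v: "C1_near ?D v" for v
  proof -
    have cv: "continuous_on ?D v" using v by (rule C1_near_continuous_on)
    \<comment> \<open>The initial slice lies in the domain of continuity of \<open>v\<close>: time 0
      belongs to the horizon and \<open>\<Omega>0 \<subseteq> \<Omega>\<close>.\<close>
    have "continuous_on \<Omega>0 (\<lambda>\<omega>. v (0, \<omega>))"
      by (rule continuous_on_compose2[OF cv])
         (use \<Omega>0 t horizon_interval_subset[OF t] t0 in \<open>auto intro!: continuous_intros\<close>)
    from has_bochner_integral_return_restrict_borel[OF this \<omega>0]
    have "has_bochner_integral \<mu>0 (\<lambda>\<omega>. v (0, \<omega>)) (v (0, \<omega>0))" by (simp add: \<mu>0_def)
    moreover have "has_bochner_integral \<mu>p v (v (t, x t))"
      unfolding \<mu>p_def by (rule has_bochner_integral_return_restrict_borel[OF cv xt(2)])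
    moreover have "has_bochner_integral \<mu> (lie_deriv f v) (v (t, x t) - v (0, \<omega>0))"
      unfolding \<mu>_def by (rule liouville_equation_trajectory[OF fD x xD v])
    ultimately show ?thesis by (simp add: has_bochner_integral_iff)
  qed
  have marg_\<omega>: "distr \<mu>p (restrict_space borel \<Omega>) snd = distr \<mu>s (restrict_space borel \<Omega>) fst"
    unfolding \<mu>p_def \<mu>s_def using xt(2) \<mu>spt
    by (subst (1 2) distr_return_restrict_borel) (auto intro!: continuous_intros)
  have marg_x: "distr \<eta> (restrict_space borel X) fst =
      distr \<mu>s (restrict_space borel X) (\<lambda>(\<omega>, s). A s \<omega>)"
    unfolding \<eta>_def \<mu>s_def using \<eta>pt \<mu>spt A' AX
    by (subst (1 2) distr_return_restrict_borel) (auto intro!: continuous_intros)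
  have w: "integrable \<eta> (\<lambda>(x, y). w x :: real) \<and> integrable \<mu>s (\<lambda>(\<omega>, s). w (A s \<omega>))"
    if cw: "continuous_on X w" for w
  proof -
    have "continuous_on (X \<times> Xu) (\<lambda>(x, y). w x)"
      unfolding case_prod_unfold by (rule continuous_on_compose2[OF cw]) (auto intro!: continuous_intros)
    moreover have "continuous_on (\<Omega> \<times> S) (\<lambda>(\<omega>, s). w (A s \<omega>))"
      unfolding case_prod_unfold
      by (rule continuous_on_compose2[OF cw A'[unfolded case_prod_unfold]]) (use AX in auto)
    ultimately show ?thesis
      using has_bochner_integral_return_restrict_borel[OF _ \<eta>pt]
        has_bochner_integral_return_restrict_borel[OF _ \<mu>spt]
      unfolding \<eta>_def \<mu>s_def by (blast intro: integrable.intros)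
  qed
  have "emeasure \<mu>0 (space \<mu>0) = 1"
    unfolding \<mu>0_def using \<omega>0
    by (intro prob_space.emeasure_space_1 prob_space_return) (simp add: space_restrict_space)
  then have "feasible T f \<Omega> \<Omega>0 A S X Xu c \<mu>0 \<mu>p \<mu> \<mu>s \<eta>"
    unfolding feasible_def
    using borel liouville marg_\<omega> marg_x w cost
    by (simp add: has_bochner_integral_iff)
  moreover have "(\<integral>(x, y). c x y \<partial>\<eta>) = c (A s (flow f \<omega>0 t)) y"
    using cost xfl[of t] t0 by (simp add: has_bochner_integral_iff)
  ultimately show ?thesis by blast
qed

section \<open>Comparison of the two infima\<close>

theorem theorem6p1:
  fixes X Xu :: "(real^'n) set"
    and \<Omega> \<Omega>0 :: "(real^'m) set"
    and S :: "(real^'k) set"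
    and T :: ereal
    and f :: "real \<Rightarrow> real^'m \<Rightarrow> real^'m"
    and A :: "real^'k \<Rightarrow> real^'m \<Rightarrow> real^'n"
    and c :: "real^'n \<Rightarrow> real^'n \<Rightarrow> real"
  assumes "Xu \<subseteq> X" and "\<Omega>0 \<subseteq> \<Omega>" and "0 \<le> T"
    and "locally_lipschitz_on (horizon T \<times> UNIV) (\<lambda>(t, \<omega>). f t \<omega>)"
    and "\<And>s \<omega>. s \<in> S \<Longrightarrow> \<omega> \<in> \<Omega> \<Longrightarrow> A s \<omega> \<in> X"
    and A3: "continuous_on (X \<times> Xu) (\<lambda>(x, y). c x y)"
    and A4: "continuous_on (S \<times> \<Omega>) (\<lambda>(s, \<omega>). A s \<omega>)"
    and A5: "compact \<Omega> \<and> compact S \<and> compact X \<and> compact Xu \<Longrightarrow>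
               no_return_orientation T f \<Omega> \<Omega>0"
    and A6: "compact \<Omega> \<and> compact S \<and> compact X \<and> compact Xu \<Longrightarrow>
               no_return_shape T f \<Omega>0 A S X"
  shows "measure_program_value T f \<Omega> \<Omega>0 A S X Xu c \<le> shape_distance T f \<Omega> \<Omega>0 A S Xu c"
  unfolding measure_program_value_def shape_distance_def
\<comment> \<open>This also covers the case without competitors, where the shape distance is the
  infimum of the empty set, that is, \<open>\<infinity>\<close>.\<close>
proof (rule Inf_greatest, elim CollectE exE conjE)
  fix z t \<omega>0 s y
  assume z: "z = ereal (c (A s (flow f \<omega>0 t)) y)"
    and adm: "admissible T f \<Omega> \<Omega>0 t \<omega>0" and s: "s \<in> S" and y: "y \<in> Xu"
  from feasible_trajectory[OF assms(2,4,5) A3 A4 adm s y] z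
  show "Inf {ereal (\<integral>(x, y). c x y \<partial>\<eta>) | \<mu>0 \<mu>p \<mu> \<mu>s \<eta>.
      feasible T f \<Omega> \<Omega>0 A S X Xu c \<mu>0 \<mu>p \<mu> \<mu>s \<eta>} \<le> z"
    by (intro Inf_lower) force
qed

end
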